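(* Let $M$ be a monoid, let $C=A\cup B$ be an $M$-act with $A$ and $B$ subacts of $C$, and suppose that $A\cap B$ is either empty or finitely generated. If $A$ and $B$ are finitely presented, then $C$ is finitely presented.
   Context: Let $M$ be a monoid with identity $1$. A (right) $M$-act is a non-empty set $A$ with a map $A\times M\to A$, $(a,m)\mapsto am$, with $a(mn)=(am)n$ and $a1=a$. A subact of $A$ is a non-empty subset $B$ with $bm\in B$ for all $b\in B$, $m\in M$. A subset $U$ generates $A$ if every $a\in A$ is $um$ for some $u\in U$, $m\in M$; $A$ is finitely generated if it has a finite generating set. A congruence on $A$ is an equivalence relation $\rho$ with $(a,b)\in\rho\Rightarrow(am,bm)\in\rho$ for all $m\in M$. For a set $X$, $F_X=X\times M$ is the free $M$-act with $(x,m)n=(x,mn)$. A presentation $\langle X\,|\,R\rangle$ consists of a non-empty set $X$ and a set $R\subseteq F_X\times F_X$; an $M$-act is defined by it if it is isomorphic to $F_X/\rho$, where $\rho$ is the smallest congruence on $F_X$ containing $R$. An $M$-act is finitely presented if it is defined by some presentation $\langle X\,|\,R\rangle$ with $X$ and $R$ finite. *)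

theory Defs
  imports "HOL-Algebra.Group"
begin

locale monoid_act = monoid M
  for M :: "('m, 'e) monoid_scheme" (structure) +
  fixes A :: "'a set" and act :: "'a \<Rightarrow> 'm \<Rightarrow> 'a" (infixl "\<cdot>" 70)
  assumes act_nonempty: "A \<noteq> {}"
    and act_closed: "\<lbrakk>a \<in> A; m \<in> carrier M\<rbrakk> \<Longrightarrow> a \<cdot> m \<in> A"
    and act_assoc: "\<lbrakk>a \<in> A; m \<in> carrier M; n \<in> carrier M\<rbrakk> \<Longrightarrow> a \<cdot> (m \<otimes> n) = (a \<cdot> m) \<cdot> n"
    and act_one: "a \<in> A \<Longrightarrow> a \<cdot> \<one> = a"

definition subact ::
  "('m, 'e) monoid_scheme \<Rightarrow> 'a set \<Rightarrow> ('a \<Rightarrow> 'm \<Rightarrow> 'a) \<Rightarrow> 'a set \<Rightarrow> bool" where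
  "subact M A act B \<longleftrightarrow>
     B \<subseteq> A \<and> B \<noteq> {} \<and> (\<forall>b\<in>B. \<forall>m\<in>carrier M. act b m \<in> B)"

definition generates ::
  "('m, 'e) monoid_scheme \<Rightarrow> 'a set \<Rightarrow> ('a \<Rightarrow> 'm \<Rightarrow> 'a) \<Rightarrow> 'a set \<Rightarrow> bool" where
  "generates M A act U \<longleftrightarrow>
     U \<subseteq> A \<and> (\<forall>a\<in>A. \<exists>u\<in>U. \<exists>m\<in>carrier M. a = act u m)"

definition finitely_generated_act ::
  "('m, 'e) monoid_scheme \<Rightarrow> 'a set \<Rightarrow> ('a \<Rightarrow> 'm \<Rightarrow> 'a) \<Rightarrow> bool" where
  "finitely_generated_act M A act \<longleftrightarrow> (\<exists>U. finite U \<and> generates M A act U)"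

definition act_congruence ::
  "('m, 'e) monoid_scheme \<Rightarrow> 'a set \<Rightarrow> ('a \<Rightarrow> 'm \<Rightarrow> 'a) \<Rightarrow> ('a \<times> 'a) set \<Rightarrow> bool" where
  "act_congruence M A act \<rho> \<longleftrightarrow>
     equiv A \<rho> \<and> (\<forall>(a, b)\<in>\<rho>. \<forall>m\<in>carrier M. (act a m, act b m) \<in> \<rho>)"

(* For R \<subseteq> A \<times> A this is the smallest congruence on A containing R; see
   congruence_gen_congruence, congruence_gen_contains and congruence_gen_least below. *)
definition congruence_gen ::
  "('m, 'e) monoid_scheme \<Rightarrow> 'a set \<Rightarrow> ('a \<Rightarrow> 'm \<Rightarrow> 'a) \<Rightarrow> ('a \<times> 'a) set \<Rightarrow> ('a \<times> 'a) set" where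
  "congruence_gen M A act R = \<Inter> {\<rho>. act_congruence M A act \<rho> \<and> R \<subseteq> \<rho>}"

(* The action on A // \<rho>, namely [a] m = [a m]; the union runs over all representatives a
   of the class K, and for a congruence \<rho> all its members coincide. *)
definition quotient_action ::
  "('a \<times> 'a) set \<Rightarrow> ('a \<Rightarrow> 'm \<Rightarrow> 'a) \<Rightarrow> 'a set \<Rightarrow> 'm \<Rightarrow> 'a set" where
  "quotient_action \<rho> act K m = (\<Union>a\<in>K. \<rho> `` {act a m})"

definition act_isomorphic ::
  "('m, 'e) monoid_scheme \<Rightarrow> 'a set \<Rightarrow> ('a \<Rightarrow> 'm \<Rightarrow> 'a) \<Rightarrow> 'b set \<Rightarrow> ('b \<Rightarrow> 'm \<Rightarrow> 'b) \<Rightarrow> bool" where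
  "act_isomorphic M A act B act' \<longleftrightarrow>
     (\<exists>f. bij_betw f A B \<and> (\<forall>a\<in>A. \<forall>m\<in>carrier M. f (act a m) = act' (f a) m))"

definition free_act :: "('m, 'e) monoid_scheme \<Rightarrow> 'x set \<Rightarrow> ('x \<times> 'm) set" where
  "free_act M X = X \<times> carrier M"

definition free_action :: "('m, 'e) monoid_scheme \<Rightarrow> 'x \<times> 'm \<Rightarrow> 'm \<Rightarrow> 'x \<times> 'm" where
  "free_action M = (\<lambda>(x, m) n. (x, m \<otimes>\<^bsub>M\<^esub> n))"

definition act_presentation ::
  "('m, 'e) monoid_scheme \<Rightarrow> 'x set \<Rightarrow> (('x \<times> 'm) \<times> ('x \<times> 'm)) set \<Rightarrow> bool" where
  "act_presentation M X R \<longleftrightarrow> X \<noteq> {} \<and> R \<subseteq> free_act M X \<times> free_act M X"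

definition act_defined_by ::
  "('m, 'e) monoid_scheme \<Rightarrow> 'a set \<Rightarrow> ('a \<Rightarrow> 'm \<Rightarrow> 'a) \<Rightarrow>
     'x set \<Rightarrow> (('x \<times> 'm) \<times> ('x \<times> 'm)) set \<Rightarrow> bool" where
  "act_defined_by M A act X R \<longleftrightarrow>
     (let \<rho> = congruence_gen M (free_act M X) (free_action M) R
      in act_isomorphic M A act (free_act M X // \<rho>) (quotient_action \<rho> (free_action M)))"

(* HOL cannot quantify existentially over the type of X. Every finite set is in bijection with
   a set of natural numbers, so letting X range over sets of naturals loses no finite
   presentation. *)
definition finitely_presented_act ::
  "('m, 'e) monoid_scheme \<Rightarrow> 'a set \<Rightarrow> ('a \<Rightarrow> 'm \<Rightarrow> 'a) \<Rightarrow> bool" where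
  "finitely_presented_act M A act \<longleftrightarrow>
     (\<exists>(X :: nat set) R. finite X \<and> finite R \<and> act_presentation M X R \<and> act_defined_by M A act X R)"

lemma monoid_act_free_act:
  assumes "monoid M" "X \<noteq> {}"
  shows "monoid_act M (free_act M X) (free_action M)"
proof -
  interpret monoid M by fact
  show ?thesis
    using assms(2) by unfold_locales (auto simp: free_act_def free_action_def m_assoc)
qed

lemma (in monoid_act) congruence_gen_congruence:
  assumes "R \<subseteq> A \<times> A"
  shows "act_congruence M A act (congruence_gen M A act R)"
proof -
  let ?S = "{\<rho>. act_congruence M A act \<rho> \<and> R \<subseteq> \<rho>}"
  have full: "A \<times> A \<in> ?S"
    using assms act_closed
    by (auto simp: act_congruence_def equiv_def refl_on_def sym_def trans_def)
  have S: "equiv A \<rho>" if "\<rho> \<in> ?S" for \<rho>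
    using that by (simp add: act_congruence_def)
  have "equiv A (\<Inter> ?S)"
  proof (rule equivI)
    show "\<Inter> ?S \<subseteq> A \<times> A" using full by blast
    show "refl_on A (\<Inter> ?S)" using S unfolding equiv_def refl_on_def by blast
    show "sym (\<Inter> ?S)" using S unfolding equiv_def sym_def by blast
    show "trans (\<Inter> ?S)" using S unfolding equiv_def trans_def by blast
  qed
  moreover have "(act a m, act b m) \<in> \<Inter> ?S" if "(a, b) \<in> \<Inter> ?S" "m \<in> carrier M" for a b m
    using that unfolding act_congruence_def by blast
  ultimately show ?thesis
    unfolding act_congruence_def congruence_gen_def by blast
qed

lemma congruence_gen_contains: "R \<subseteq> congruence_gen M A act R"
  unfolding congruence_gen_def by blast

lemma congruence_gen_least:
  "\<lbrakk>act_congruence M A act \<rho>; R \<subseteq> \<rho>\<rbrakk> \<Longrightarrow> congruence_gen M A act R \<subseteq> \<rho>"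
  unfolding congruence_gen_def by blast

lemma quotient_action_class:
  assumes "act_congruence M A act \<rho>" "a \<in> A" "m \<in> carrier M"
  shows "quotient_action \<rho> act (\<rho> `` {a}) m = \<rho> `` {act a m}"
proof -
  have eq: "equiv A \<rho>" and "\<forall>b. (a, b) \<in> \<rho> \<longrightarrow> (act a m, act b m) \<in> \<rho>"
    using assms by (auto simp: act_congruence_def)
  then have "\<rho> `` {act b m} = \<rho> `` {act a m}" if "(a, b) \<in> \<rho>" for b
    using that equiv_class_eq[OF eq] by blast
  moreover have "(a, a) \<in> \<rho>" using eq assms(2) by (simp add: equiv_def refl_on_def)
  ultimately show ?thesis unfolding quotient_action_def by blast
qed

end

(* An act C is defined by a presentation with generators X and relations R iff some homomorphism
   from the free act on X onto C has the congruence generated by R as its kernel.  Given such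
   homomorphisms hA, hB for A, B and a finite generating set U of the intersection, choose for
   every u in U words p u, q u with hA (p u) = u = hB (q u).  Then C is presented on the disjoint
   union of the generators by the relations of A and of B together with the pairs (p u, q u):
   if hA v = hB w, this common value is some u m, and v ~ (p u) m ~ (q u) m ~ w. *)
theory Submission
  imports Defs
begin

definition act_hom ::
  "('m, 'e) monoid_scheme \<Rightarrow> 'a set \<Rightarrow> ('a \<Rightarrow> 'm \<Rightarrow> 'a) \<Rightarrow> 'b set \<Rightarrow> ('b \<Rightarrow> 'm \<Rightarrow> 'b) \<Rightarrow> ('a \<Rightarrow> 'b) \<Rightarrow> bool"
  where
  "act_hom M A act B act' f \<longleftrightarrow>
     f ` A \<subseteq> B \<and> (\<forall>a\<in>A. \<forall>m\<in>carrier M. f (act a m) = act' (f a) m)"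

lemma act_homD:
  assumes "act_hom M A act B act' f" "a \<in> A"
  shows "f a \<in> B" "m \<in> carrier M \<Longrightarrow> f (act a m) = act' (f a) m"
  using assms unfolding act_hom_def by auto

lemma act_congruenceD:
  assumes "act_congruence M A act \<rho>"
  shows "equiv A \<rho>" "\<lbrakk>(a, b) \<in> \<rho>; m \<in> carrier M\<rbrakk> \<Longrightarrow> (act a m, act b m) \<in> \<rho>"
  using assms unfolding act_congruence_def by auto

text \<open>Equivalence properties transfer pointwise through \<open>f\<close>, and compatibility
  with the action holds because \<open>f\<close> commutes with it. For equality as
  \<open>\<sigma>\<close> this is the kernel of \<open>f\<close>.\<close>

lemma (in monoid_act) act_congruence_pullback:
  assumes hom: "act_hom M A act B act' f" and \<sigma>: "act_congruence M B act' \<sigma>"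
  shows "act_congruence M A act {(a, b) \<in> A \<times> A. (f a, f b) \<in> \<sigma>}"
proof -
  let ?\<rho> = "{(a, b) \<in> A \<times> A. (f a, f b) \<in> \<sigma>}"
  have eq: "equiv B \<sigma>"
    using \<sigma> by (rule act_congruenceD)
  have "equiv A ?\<rho>"
  proof (rule equivI)
    show "?\<rho> \<subseteq> A \<times> A" by blast
    show "refl_on A ?\<rho>"
      using eq act_homD(1)[OF hom] by (auto simp: equiv_def refl_on_def)
    show "sym ?\<rho>" using eq by (auto simp: equiv_def sym_def)
    show "trans ?\<rho>" using eq unfolding equiv_def trans_def by blast
  qed
  then show ?thesis
    using act_congruenceD(2)[OF \<sigma>] act_closed act_homD(2)[OF hom]
    unfolding act_congruence_def by auto
qed

text \<open>The pullback of \<open>\<sigma>\<close> along \<open>f\<close> is a congruence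
  containing \<open>R\<close>, hence contains the one that \<open>R\<close> generates. So a property
  of all consequences of \<open>R\<close> need only be checked on \<open>R\<close> itself.\<close>

lemma (in monoid_act) congruence_gen_map:
  assumes "act_hom M A act B act' f" "act_congruence M B act' \<sigma>" "R \<subseteq> A \<times> A"
    and "\<And>a b. (a, b) \<in> R \<Longrightarrow> (f a, f b) \<in> \<sigma>"
    and "(p, q) \<in> congruence_gen M A act R"
  shows "(f p, f q) \<in> \<sigma>"
proof -
  have "congruence_gen M A act R \<subseteq> {(a, b) \<in> A \<times> A. (f a, f b) \<in> \<sigma>}"
    using assms(3,4) by (intro congruence_gen_least act_congruence_pullback[OF assms(1,2)]) auto
  with assms(5) show ?thesis by auto
qed

text \<open>With equality as the target congruence, \<open>congruence_gen_map\<close> says that a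
  homomorphism respecting the relations respects all their consequences.\<close>

lemma (in monoid_act) act_congruence_Id_on: "act_congruence M A act (Id_on A)"
  using act_closed equiv_def refl_on_Id_on sym_Id_on trans_Id_on
  by (fastforce simp: act_congruence_def)

lemma (in monoid_act) monoid_act_subact: "subact M A act B \<Longrightarrow> monoid_act M B act"
  by (rule monoid_act.intro[OF monoid_axioms], unfold_locales)
    (auto simp: subact_def subset_iff act_assoc act_one)

text \<open>This is the first isomorphism theorem for acts. It trades the isomorphism with a
  quotient for a surjection from the free act, so that later arguments compute with words instead of
  classes.\<close>

lemma (in monoid_act) act_defined_by_iff:
  assumes pres: "act_presentation M X R"
  shows "act_defined_by M A act X R \<longleftrightarrow>
    (\<exists>h. act_hom M (free_act M X) (free_action M) A act h \<and> h ` free_act M X = A \<and>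
      (\<forall>p\<in>free_act M X. \<forall>q\<in>free_act M X.
        (p, q) \<in> congruence_gen M (free_act M X) (free_action M) R \<longleftrightarrow> h p = h q))"
proof -
  let ?F = "free_act M X" and ?fa = "free_action M"
  define \<rho> where "\<rho> = congruence_gen M ?F ?fa R"
  interpret F: monoid_act M ?F ?fa
    using pres by (intro monoid_act_free_act monoid_axioms) (simp add: act_presentation_def)
  have cong: "act_congruence M ?F ?fa \<rho>"
    using F.congruence_gen_congruence pres unfolding \<rho>_def act_presentation_def by blast
  have eq: "equiv ?F \<rho>"
    using cong by (rule act_congruenceD)
  show ?thesis
    unfolding act_defined_by_def Let_def act_isomorphic_def \<rho>_def[symmetric]
  proof (intro iffI; elim exE conjE)
    fix f
    assume bij: "bij_betw f A (?F // \<rho>)"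
      and equiva: "\<forall>a\<in>A. \<forall>m\<in>carrier M. f (act a m) = quotient_action \<rho> ?fa (f a) m"
    \<comment> \<open>The quotient map followed by the inverse of the isomorphism
      \<open>f\<close>.\<close>
    define h where "h p = inv_into A f (\<rho> `` {p})" for p
    have h: "h p \<in> A" "f (h p) = \<rho> `` {p}" if "p \<in> ?F" for p
      using that bij_betw_imp_surj_on[OF bij] quotientI[of p ?F \<rho>]
      by (auto simp: h_def inv_into_into f_inv_into_f)
    have inj: "a = b" if "a \<in> A" "b \<in> A" "f a = f b" for a b
      using bij that by (auto simp: bij_betw_def inj_on_def)
    \<comment> \<open>By injectivity it suffices to compare images under \<open>f\<close>: both are
      the class of \<open>?fa p m\<close>.\<close>
    have "h (?fa p m) = act (h p) m" if "p \<in> ?F" "m \<in> carrier M" for p m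
      using that h h[OF F.act_closed] act_closed equiva quotient_action_class[OF cong]
      by (intro inj) auto
    then have hom: "act_hom M ?F ?fa A act h"
      using h by (auto simp: act_hom_def)
    have "a \<in> h ` ?F" if "a \<in> A" for a
    proof -
      have "f a \<in> ?F // \<rho>" using bij that by (auto simp: bij_betw_def)
      then obtain p where "p \<in> ?F" "f a = \<rho> `` {p}" by (rule quotientE)
      then show ?thesis using inj[of a "h p"] h that by auto
    qed
    then have surj: "h ` ?F = A" using h by blast
    have "(p, q) \<in> \<rho> \<longleftrightarrow> h p = h q" if "p \<in> ?F" "q \<in> ?F" for p q
      using that eq_equiv_class_iff[OF eq that] h inj by metis
    with hom surj
    show "\<exists>h. act_hom M ?F ?fa A act h \<and> h ` ?F = A \<and>
        (\<forall>p\<in>?F. \<forall>q\<in>?F. (p, q) \<in> \<rho> \<longleftrightarrow> h p = h q)"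
      by blast
  next
    fix h
    assume hom: "act_hom M ?F ?fa A act h" and surj: "h ` ?F = A"
      and ker: "\<forall>p\<in>?F. \<forall>q\<in>?F. (p, q) \<in> \<rho> \<longleftrightarrow> h p = h q"
    \<comment> \<open>The fibres of \<open>h\<close> are exactly the classes of its kernel
      \<open>\<rho>\<close>, so no representative has to be chosen.\<close>
    define f where "f a = {p \<in> ?F. h p = a}" for a
    have f: "f (h p) = \<rho> `` {p}" if "p \<in> ?F" for p
      using that ker eq by (auto simp: f_def equiv_def)
    \<comment> \<open>Since \<open>h\<close> is onto, every fibre is non-empty and thus determines
      its value.\<close>
    have "inj_on f A"
      unfolding inj_on_def f_def using surj by blast
    moreover have "f ` A = ?F // \<rho>"
      using f surj by (force simp: quotient_def)
    ultimately have "bij_betw f A (?F // \<rho>)" by (simp add: bij_betw_def)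
    moreover have "f (act a m) = quotient_action \<rho> ?fa (f a) m"
      if "a \<in> A" "m \<in> carrier M" for a m
    proof -
      obtain p where p: "p \<in> ?F" "a = h p" using surj \<open>a \<in> A\<close> by blast
      then have "f (act a m) = f (h (?fa p m))"
        using act_homD(2)[OF hom] that by simp
      also have "\<dots> = quotient_action \<rho> ?fa (f a) m"
        using p that f F.act_closed quotient_action_class[OF cong] by simp
      finally show ?thesis .
    qed
    ultimately show "\<exists>f. bij_betw f A (?F // \<rho>) \<and>
        (\<forall>a\<in>A. \<forall>m\<in>carrier M. f (act a m) = quotient_action \<rho> ?fa (f a) m)"
      by blast
  qed
qed

lemma act_hom_free_act_map:
  assumes "g ` X \<subseteq> Y" "monoid M"
  shows "act_hom M (free_act M X) (free_action M) (free_act M Y) (free_action M) (map_prod g id)"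
  using assms by (auto simp: act_hom_def free_act_def free_action_def)

text \<open>The set \<open>U\<close> may be empty, so an empty and a finitely generated intersection
  are handled together.\<close>

lemma finitely_presented_act_amalgam:
  fixes M :: "('m, 'e) monoid_scheme"
  assumes C: "monoid_act M C act" and CAB: "C = A \<union> B"
    and A: "subact M C act A" and B: "subact M C act B"
    and U: "finite U" "U \<subseteq> A \<inter> B" "\<And>c. c \<in> A \<inter> B \<Longrightarrow> \<exists>u\<in>U. \<exists>m\<in>carrier M. c = act u m"
    and fpA: "finitely_presented_act M A act" and fpB: "finitely_presented_act M B act"
  shows "finitely_presented_act M C act"
proof -
  interpret C: monoid_act M C act by fact
  interpret A: monoid_act M A act by (rule C.monoid_act_subact[OF A])
  interpret B: monoid_act M B act by (rule C.monoid_act_subact[OF B])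
  note M = C.monoid_axioms
  let ?fa = "free_action M"
  obtain X :: "nat set" and R where X: "finite X" "finite R" and presX: "act_presentation M X R"
    and "act_defined_by M A act X R"
    using fpA unfolding finitely_presented_act_def by blast
  then obtain h where h: "act_hom M (free_act M X) ?fa A act h" and sh: "h ` free_act M X = A"
    and kh: "\<And>p q. p \<in> free_act M X \<Longrightarrow> q \<in> free_act M X \<Longrightarrow>
      (p, q) \<in> congruence_gen M (free_act M X) ?fa R \<longleftrightarrow> h p = h q"
    using A.act_defined_by_iff[OF presX] by blast
  obtain Y :: "nat set" and S where Y: "finite Y" "finite S" and presY: "act_presentation M Y S"
    and "act_defined_by M B act Y S"
    using fpB unfolding finitely_presented_act_def by blast
  then obtain k where k: "act_hom M (free_act M Y) ?fa B act k" and sk: "k ` free_act M Y = B"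
    and kk: "\<And>p q. p \<in> free_act M Y \<Longrightarrow> q \<in> free_act M Y \<Longrightarrow>
      (p, q) \<in> congruence_gen M (free_act M Y) ?fa S \<longleftrightarrow> k p = k q"
    using B.act_defined_by_iff[OF presY] by blast
  interpret FX: monoid_act M "free_act M X" ?fa
    using presX by (intro monoid_act_free_act M) (simp add: act_presentation_def)
  interpret FY: monoid_act M "free_act M Y" ?fa
    using presY by (intro monoid_act_free_act M) (simp add: act_presentation_def)
  have R: "R \<subseteq> free_act M X \<times> free_act M X" and S: "S \<subseteq> free_act M Y \<times> free_act M Y"
    using presX presY by (auto simp: act_presentation_def)

  \<comment> \<open>The disjoint union must again consist of naturals: generators of
    \<open>A\<close> become even, those of \<open>B\<close> odd.\<close>
  define Z where "Z = (\<lambda>n. 2 * n) ` X \<union> (\<lambda>n. Suc (2 * n)) ` Y"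
  define i :: "nat \<times> 'm \<Rightarrow> nat \<times> 'm" where "i = map_prod (\<lambda>n. 2 * n) id"
  define j :: "nat \<times> 'm \<Rightarrow> nat \<times> 'm" where "j = map_prod (\<lambda>n. Suc (2 * n)) id"
  \<comment> \<open>\<open>h\<close> and \<open>k\<close> glued along parity; \<open>n div 2\<close>
    recovers the old generator in both cases, as rounding down discards the
    \<open>Suc\<close>.\<close>
  define l where "l = (\<lambda>(n, m). if even n then h (n div 2, m) else k (n div 2, m))"
  have i: "act_hom M (free_act M X) ?fa (free_act M Z) ?fa i"
    and j: "act_hom M (free_act M Y) ?fa (free_act M Z) ?fa j"
    unfolding i_def j_def by (intro act_hom_free_act_map M; auto simp: Z_def)+
  have li [simp]: "l (i p) = h p" and lj [simp]: "l (j p) = k p" for p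
    by (cases p; simp add: l_def i_def j_def)+
  have FZ: "free_act M Z = i ` free_act M X \<union> j ` free_act M Y"
    unfolding free_act_def Z_def i_def j_def
    by (simp add: Sigma_Un_distrib1 map_prod_surj_on[OF refl refl])
  have sl: "l ` free_act M Z = C"
    using sh sk unfolding FZ CAB image_Un by (auto simp: image_image)
  have l: "act_hom M (free_act M Z) ?fa C act l"
    unfolding act_hom_def
  proof (intro conjI ballI)
    fix p m assume "p \<in> free_act M Z" and m: "m \<in> carrier M"
    then consider q where "q \<in> free_act M X" "p = i q" | q where "q \<in> free_act M Y" "p = j q"
      unfolding FZ by blast
    then show "l (?fa p m) = act (l p) m"
    proof cases
      case 1
      then have "l (?fa p m) = l (i (?fa q m))" using act_homD(2)[OF i] m by simp
      with 1 show ?thesis using act_homD(2)[OF h] m by simp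
    next
      case 2
      then have "l (?fa p m) = l (j (?fa q m))" using act_homD(2)[OF j] m by simp
      with 2 show ?thesis using act_homD(2)[OF k] m by simp
    qed
  qed (simp add: sl)

  define p where "p = inv_into (free_act M X) h"
  define q where "q = inv_into (free_act M Y) k"
  have p: "p u \<in> free_act M X" "h (p u) = u" and q: "q u \<in> free_act M Y" "k (q u) = u"
    if "u \<in> U" for u
    using that U(2) sh sk inv_into_into[of u h] inv_into_into[of u k] f_inv_into_f[of u h]
      f_inv_into_f[of u k] unfolding p_def q_def by blast+
  define T where "T = map_prod i i ` R \<union> map_prod j j ` S \<union> (\<lambda>u. (i (p u), j (q u))) ` U"
  define \<tau> where "\<tau> = congruence_gen M (free_act M Z) ?fa T"
  have T: "T \<subseteq> free_act M Z \<times> free_act M Z"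
    using R S p q by (auto simp: T_def FZ)
  have presZ: "act_presentation M Z T"
    using T presX by (auto simp: act_presentation_def Z_def)
  interpret FZ: monoid_act M "free_act M Z" ?fa
    using presZ by (intro monoid_act_free_act M) (simp add: act_presentation_def)
  have \<tau>: "act_congruence M (free_act M Z) ?fa \<tau>"
    unfolding \<tau>_def by (rule FZ.congruence_gen_congruence[OF T])
  have sym: "(b, a) \<in> \<tau>" if "(a, b) \<in> \<tau>" for a b
    using act_congruenceD(1)[OF \<tau>] that by (auto simp: equiv_def dest: symD)
  have trans: "(a, c) \<in> \<tau>" if "(a, b) \<in> \<tau>" "(b, c) \<in> \<tau>" for a b c
    using act_congruenceD(1)[OF \<tau>] that by (auto simp: equiv_def dest: transD)
  have T\<tau>: "T \<subseteq> \<tau>"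
    unfolding \<tau>_def by (rule congruence_gen_contains)
  \<comment> \<open>Equal values under \<open>h\<close> mean that the pair follows from
    \<open>R\<close>, and \<open>i\<close> carries \<open>R\<close> into \<open>T\<close>.\<close>
  have XX: "(i v, i w) \<in> \<tau>" if "v \<in> free_act M X" "w \<in> free_act M X" "h v = h w" for v w
  proof (rule FX.congruence_gen_map[OF i \<tau> R])
    show "(i a, i b) \<in> \<tau>" if "(a, b) \<in> R" for a b
      using that T\<tau> by (force simp: T_def)
    show "(v, w) \<in> congruence_gen M (free_act M X) ?fa R"
      using that kh by blast
  qed
  have YY: "(j v, j w) \<in> \<tau>" if "v \<in> free_act M Y" "w \<in> free_act M Y" "k v = k w" for v w
  proof (rule FY.congruence_gen_map[OF j \<tau> S])
    show "(j a, j b) \<in> \<tau>" if "(a, b) \<in> S" for a b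
      using that T\<tau> by (force simp: T_def)
    show "(v, w) \<in> congruence_gen M (free_act M Y) ?fa S"
      using that kk by blast
  qed
  have XY: "(i v, j w) \<in> \<tau>" if v: "v \<in> free_act M X" and w: "w \<in> free_act M Y"
    and vw: "h v = k w" for v w
  proof -
    have "h v \<in> A \<inter> B"
      using act_homD(1)[OF h v] act_homD(1)[OF k w] vw by simp
    then obtain u m where u: "u \<in> U" "m \<in> carrier M" "h v = act u m"
      using U(3) by blast
    have "(i v, i (?fa (p u) m)) \<in> \<tau>"
      using u p act_homD(2)[OF h] FX.act_closed v by (intro XX) auto
    moreover have "(i (?fa (p u) m), j (?fa (q u) m)) \<in> \<tau>"
    \<comment> \<open>The defining pair for \<open>u\<close> is multiplied by \<open>m\<close>; then
      \<open>m\<close> is moved inside \<open>i\<close> and \<open>j\<close>.\<close>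
    proof -
      have "(i (p u), j (q u)) \<in> \<tau>" using u T\<tau> by (auto simp: T_def)
      then have "(?fa (i (p u)) m, ?fa (j (q u)) m) \<in> \<tau>"
        using act_congruenceD(2)[OF \<tau>] u by blast
      then show ?thesis
        using u p q act_homD(2)[OF i] act_homD(2)[OF j] by simp
    qed
    moreover have "(j (?fa (q u) m), j w) \<in> \<tau>"
      using u q act_homD(2)[OF k] FY.act_closed w vw by (intro YY) auto
    ultimately show ?thesis using trans by blast
  qed
  have "(v, w) \<in> \<tau> \<longleftrightarrow> l v = l w" if vw: "v \<in> free_act M Z" "w \<in> free_act M Z" for v w
  proof
    assume "(v, w) \<in> \<tau>"
    \<comment> \<open>Soundness: \<open>l\<close> equates the two sides of each pair in
      \<open>T\<close>, by \<open>kh\<close> and \<open>kk\<close> for the old relations and by the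
      choice of \<open>p\<close> and \<open>q\<close> for the new ones.\<close>
    have "(l v, l w) \<in> Id_on C"
    proof (rule FZ.congruence_gen_map[OF l C.act_congruence_Id_on T])
      show "(v, w) \<in> congruence_gen M (free_act M Z) ?fa T"
        using \<open>(v, w) \<in> \<tau>\<close> unfolding \<tau>_def .
      show "(l a, l b) \<in> Id_on C" if ab: "(a, b) \<in> T" for a b
      proof -
        have "h x = h y" if "(x, y) \<in> R" for x y
          using kh R congruence_gen_contains that by blast
        moreover have "k x = k y" if "(x, y) \<in> S" for x y
          using kk S congruence_gen_contains that by blast
        ultimately have "l a = l b"
          using ab p q by (auto simp: T_def)
        moreover have "l a \<in> C" using T ab sl by blast
        ultimately show ?thesis by (simp add: Id_on_iff)
      qed
    qed
    then show "l v = l w" by auto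
  next
    assume "l v = l w"
    then show "(v, w) \<in> \<tau>"
      \<comment> \<open>Each of \<open>v\<close> and \<open>w\<close> comes from \<open>X\<close> or
        from \<open>Y\<close>; the symmetric form of \<open>XY\<close> settles the case where
        \<open>v\<close> comes from \<open>Y\<close> and \<open>w\<close> from
        \<open>X\<close>.\<close>
      using vw XX YY XY sym[OF XY] unfolding FZ by (elim UnE imageE) simp_all
  qed
  then have "act_defined_by M C act Z T"
    unfolding C.act_defined_by_iff[OF presZ] \<tau>_def using l sl by blast
  moreover have "finite Z" "finite T"
    using X Y U(1) by (auto simp: Z_def T_def)
  ultimately show ?thesis
    unfolding finitely_presented_act_def using presZ by blast
qed

theorem corollary5p6:
  fixes M :: "('m, 'e) monoid_scheme"
    and A B C :: "'a set"
    and act :: "'a \<Rightarrow> 'm \<Rightarrow> 'a"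
  assumes "monoid M"
    and "monoid_act M C act"
    and "C = A \<union> B"
    and "subact M C act A"
    and "subact M C act B"
    and "A \<inter> B = {} \<or> finitely_generated_act M (A \<inter> B) act"
    and "finitely_presented_act M A act"
    and "finitely_presented_act M B act"
  shows "finitely_presented_act M C act"
proof -
  obtain U where "finite U" "U \<subseteq> A \<inter> B"
    "\<And>c. c \<in> A \<inter> B \<Longrightarrow> \<exists>u\<in>U. \<exists>m\<in>carrier M. c = act u m"
    using assms(6)
  proof
    assume "A \<inter> B = {}"
    then show ?thesis by (intro that[of "{}"]) auto
  next
    assume "finitely_generated_act M (A \<inter> B) act"
    then show ?thesis
      unfolding finitely_generated_act_def generates_def using that by blast
  qed
  then show ?thesis
    using finitely_presented_act_amalgam assms(2-5,7,8) by blast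
qed

end
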